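(* Let $\mathbf A$ be a connexive Heyting algebra, let $\overline A=\{\neg\neg a:a\in A\}$, and define on $\overline A$ the operations $x\Cap y:=x\wedge y$ and $x\Cup y:=\neg\neg(x\vee y)$. Then $\overline{\mathbf A}=\langle\overline A,\Cap,\Cup,\rightarrow,0,1\rangle$ (with $\rightarrow$ the restriction of that of $\mathbf A$) is a connexive Boolean algebra, and the map $a\mapsto\neg\neg a$ from $A$ onto $\overline A$ is a surjective map preserving $\wedge$, $\rightarrow$, $0$ and $1$.
   Context: A connexive Heyting algebra is an algebra $\langle A,\wedge,\vee,\rightarrow,0,1\rangle$ whose $\{\wedge,\vee,0,1\}$-reduct is a bounded distributive lattice with lattice order $\le$, satisfying, with $\neg x:=x\rightarrow0$: (C1) $(x\rightarrow y)\rightarrow((y\rightarrow z)\rightarrow(x\rightarrow z))=1$; (C2) $(x\rightarrow y)\rightarrow\neg(x\rightarrow\neg y)=1$; (C3) $x\wedge(x\rightarrow y)=x\wedge y$; (C4) $x\rightarrow y\le(z\wedge x)\rightarrow(z\wedge y)$; (C5) $x\rightarrow y\le(z\vee x)\rightarrow(z\vee y)$. A connexive Boolean algebra is a connexive Heyting algebra satisfying additionally $\neg\neg x=x$ for all $x$. *)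

theory Defs
  imports Main "HOL-Algebra.Congruence"
begin

record 'a heyting_struct = "'a partial_object" +
  meet :: "'a \<Rightarrow> 'a \<Rightarrow> 'a" (infixl \<open>\<sqinter>\<index>\<close> 70)
  join :: "'a \<Rightarrow> 'a \<Rightarrow> 'a" (infixl \<open>\<squnion>\<index>\<close> 65)
  imp  :: "'a \<Rightarrow> 'a \<Rightarrow> 'a" (infixr \<open>\<leadsto>\<index>\<close> 60)
  zero :: "'a" (\<open>\<zero>\<index>\<close>)
  one  :: "'a" (\<open>\<one>\<index>\<close>)

definition lat_le :: "('a, 'b) heyting_struct_scheme \<Rightarrow> 'a \<Rightarrow> 'a \<Rightarrow> bool" (infix \<open>\<sqsubseteq>\<index>\<close> 50)
  where "x \<sqsubseteq>\<^bsub>A\<^esub> y \<longleftrightarrow> x \<sqinter>\<^bsub>A\<^esub> y = x"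

definition neg :: "('a, 'b) heyting_struct_scheme \<Rightarrow> 'a \<Rightarrow> 'a" (\<open>\<sim>\<index> _\<close> [81] 80)
  where "\<sim>\<^bsub>A\<^esub> x = x \<leadsto>\<^bsub>A\<^esub> \<zero>\<^bsub>A\<^esub>"

locale bounded_distributive_lattice =
  fixes A (structure)
  assumes meet_closed: "\<lbrakk>x \<in> carrier A; y \<in> carrier A\<rbrakk> \<Longrightarrow> x \<sqinter> y \<in> carrier A"
    and join_closed: "\<lbrakk>x \<in> carrier A; y \<in> carrier A\<rbrakk> \<Longrightarrow> x \<squnion> y \<in> carrier A"
    and zero_closed: "\<zero> \<in> carrier A"
    and one_closed: "\<one> \<in> carrier A"
    and meet_commute: "\<lbrakk>x \<in> carrier A; y \<in> carrier A\<rbrakk> \<Longrightarrow> x \<sqinter> y = y \<sqinter> x"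
    and join_commute: "\<lbrakk>x \<in> carrier A; y \<in> carrier A\<rbrakk> \<Longrightarrow> x \<squnion> y = y \<squnion> x"
    and meet_assoc: "\<lbrakk>x \<in> carrier A; y \<in> carrier A; z \<in> carrier A\<rbrakk>
          \<Longrightarrow> (x \<sqinter> y) \<sqinter> z = x \<sqinter> (y \<sqinter> z)"
    and join_assoc: "\<lbrakk>x \<in> carrier A; y \<in> carrier A; z \<in> carrier A\<rbrakk>
          \<Longrightarrow> (x \<squnion> y) \<squnion> z = x \<squnion> (y \<squnion> z)"
    and meet_join_absorb: "\<lbrakk>x \<in> carrier A; y \<in> carrier A\<rbrakk> \<Longrightarrow> x \<sqinter> (x \<squnion> y) = x"
    and join_meet_absorb: "\<lbrakk>x \<in> carrier A; y \<in> carrier A\<rbrakk> \<Longrightarrow> x \<squnion> (x \<sqinter> y) = x"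
    and meet_join_distrib: "\<lbrakk>x \<in> carrier A; y \<in> carrier A; z \<in> carrier A\<rbrakk>
          \<Longrightarrow> x \<sqinter> (y \<squnion> z) = (x \<sqinter> y) \<squnion> (x \<sqinter> z)"
    and zero_least: "x \<in> carrier A \<Longrightarrow> \<zero> \<sqsubseteq> x"
    and one_greatest: "x \<in> carrier A \<Longrightarrow> x \<sqsubseteq> \<one>"

locale connexive_heyting_algebra = bounded_distributive_lattice A for A (structure) +
  assumes imp_closed: "\<lbrakk>x \<in> carrier A; y \<in> carrier A\<rbrakk> \<Longrightarrow> x \<leadsto> y \<in> carrier A"
    and C1: "\<lbrakk>x \<in> carrier A; y \<in> carrier A; z \<in> carrier A\<rbrakk>
          \<Longrightarrow> (x \<leadsto> y) \<leadsto> ((y \<leadsto> z) \<leadsto> (x \<leadsto> z)) = \<one>"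
    and C2: "\<lbrakk>x \<in> carrier A; y \<in> carrier A\<rbrakk> \<Longrightarrow> (x \<leadsto> y) \<leadsto> \<sim> (x \<leadsto> \<sim> y) = \<one>"
    and C3: "\<lbrakk>x \<in> carrier A; y \<in> carrier A\<rbrakk> \<Longrightarrow> x \<sqinter> (x \<leadsto> y) = x \<sqinter> y"
    and C4: "\<lbrakk>x \<in> carrier A; y \<in> carrier A; z \<in> carrier A\<rbrakk>
          \<Longrightarrow> x \<leadsto> y \<sqsubseteq> (z \<sqinter> x) \<leadsto> (z \<sqinter> y)"
    and C5: "\<lbrakk>x \<in> carrier A; y \<in> carrier A; z \<in> carrier A\<rbrakk>
          \<Longrightarrow> x \<leadsto> y \<sqsubseteq> (z \<squnion> x) \<leadsto> (z \<squnion> y)"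

locale connexive_boolean_algebra = connexive_heyting_algebra A for A (structure) +
  assumes double_neg: "x \<in> carrier A \<Longrightarrow> \<sim> (\<sim> x) = x"

definition double_neg_algebra :: "'a heyting_struct \<Rightarrow> 'a heyting_struct" where
  "double_neg_algebra A =
     \<lparr>carrier = {\<sim>\<^bsub>A\<^esub> (\<sim>\<^bsub>A\<^esub> a) | a. a \<in> carrier A},
      meet = (\<lambda>x y. x \<sqinter>\<^bsub>A\<^esub> y),
      join = (\<lambda>x y. \<sim>\<^bsub>A\<^esub> (\<sim>\<^bsub>A\<^esub> (x \<squnion>\<^bsub>A\<^esub> y))),
      imp = (\<lambda>x y. x \<leadsto>\<^bsub>A\<^esub> y),
      zero = \<zero>\<^bsub>A\<^esub>,
      one = \<one>\<^bsub>A\<^esub>\<rparr>"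

text \<open>Preservation of joins is deliberately not required.\<close>

definition preserves_meet_imp_bounds ::
    "'a heyting_struct \<Rightarrow> 'b heyting_struct \<Rightarrow> ('a \<Rightarrow> 'b) \<Rightarrow> bool" where
  "preserves_meet_imp_bounds A B h \<longleftrightarrow>
     (\<forall>x \<in> carrier A. \<forall>y \<in> carrier A. h (x \<sqinter>\<^bsub>A\<^esub> y) = h x \<sqinter>\<^bsub>B\<^esub> h y) \<and>
     (\<forall>x \<in> carrier A. \<forall>y \<in> carrier A. h (x \<leadsto>\<^bsub>A\<^esub> y) = h x \<leadsto>\<^bsub>B\<^esub> h y) \<and>
     h \<zero>\<^bsub>A\<^esub> = \<zero>\<^bsub>B\<^esub> \<and>
     h \<one>\<^bsub>A\<^esub> = \<one>\<^bsub>B\<^esub>"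

end

theory Submission
  imports Defs
begin

text \<open>
  Although \<open>\<leadsto>\<close> is not determined by the lattice, it is squeezed: \<open>u \<sqsubseteq> x \<leadsto> y\<close> whenever
  \<open>u \<sqinter> x = u \<sqinter> y\<close>, so \<open>\<leadsto>\<close> lies above the intuitionistic biconditional, while \<open>x \<leadsto> y\<close> meets
  \<open>x\<close> inside \<open>y\<close> and meets \<open>y\<close> inside \<open>\<sim> (\<sim> x)\<close>. The lower bound makes \<open>\<sim>\<close> the pseudocomplement,
  so double negation is the usual closure operator onto a Boolean algebra of regular elements;
  there both bounds agree and \<open>\<leadsto>\<close> is the biconditional, whence double negation preserves it.
\<close>

section \<open>Order and bounds in a bounded distributive lattice\<close>

context bounded_distributive_lattice
begin

lemmas lattice_closed [simp, intro] = meet_closed join_closed zero_closed one_closed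

lemma meet_idem: "x \<in> carrier A \<Longrightarrow> x \<sqinter> x = x"
  by (metis join_meet_absorb meet_join_absorb meet_closed)

lemma le_refl: "x \<in> carrier A \<Longrightarrow> x \<sqsubseteq> x"
  by (simp add: lat_le_def meet_idem)

lemma le_antisym: "\<lbrakk>x \<sqsubseteq> y; y \<sqsubseteq> x; x \<in> carrier A; y \<in> carrier A\<rbrakk> \<Longrightarrow> x = y"
  unfolding lat_le_def by (metis meet_commute)

lemma le_trans:
  "\<lbrakk>x \<sqsubseteq> y; y \<sqsubseteq> z; x \<in> carrier A; y \<in> carrier A; z \<in> carrier A\<rbrakk> \<Longrightarrow> x \<sqsubseteq> z"
  unfolding lat_le_def by (metis meet_assoc)

lemma meet_le1: "\<lbrakk>x \<in> carrier A; y \<in> carrier A\<rbrakk> \<Longrightarrow> x \<sqinter> y \<sqsubseteq> x"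
  unfolding lat_le_def by (metis meet_assoc meet_commute meet_idem)

lemma meet_le2: "\<lbrakk>x \<in> carrier A; y \<in> carrier A\<rbrakk> \<Longrightarrow> x \<sqinter> y \<sqsubseteq> y"
  by (metis meet_commute meet_le1)

lemma le_meetI:
  "\<lbrakk>z \<sqsubseteq> x; z \<sqsubseteq> y; x \<in> carrier A; y \<in> carrier A; z \<in> carrier A\<rbrakk> \<Longrightarrow> z \<sqsubseteq> x \<sqinter> y"
  unfolding lat_le_def by (metis meet_assoc)

lemma meet_mono:
  "\<lbrakk>x \<sqsubseteq> x'; y \<sqsubseteq> y'; x \<in> carrier A; y \<in> carrier A; x' \<in> carrier A; y' \<in> carrier A\<rbrakk>
    \<Longrightarrow> x \<sqinter> y \<sqsubseteq> x' \<sqinter> y'"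
  by (meson le_meetI le_trans meet_closed meet_le1 meet_le2)

lemma le_zero: "\<lbrakk>x \<sqsubseteq> \<zero>; x \<in> carrier A\<rbrakk> \<Longrightarrow> x = \<zero>"
  by (simp add: le_antisym zero_least)

lemma meet_one [simp]: "x \<in> carrier A \<Longrightarrow> x \<sqinter> \<one> = x"
  using one_greatest by (simp add: lat_le_def)

lemma one_meet [simp]: "x \<in> carrier A \<Longrightarrow> \<one> \<sqinter> x = x"
  by (metis meet_commute meet_one one_closed)

lemma zero_meet [simp]: "x \<in> carrier A \<Longrightarrow> \<zero> \<sqinter> x = \<zero>"
  using zero_least by (simp add: lat_le_def)

lemma meet_zero [simp]: "x \<in> carrier A \<Longrightarrow> x \<sqinter> \<zero> = \<zero>"
  by (metis meet_commute zero_meet zero_closed)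

lemma zero_join [simp]: "x \<in> carrier A \<Longrightarrow> \<zero> \<squnion> x = x"
  by (metis join_commute join_meet_absorb meet_zero zero_closed)

lemma join_absorb2: "\<lbrakk>x \<sqsubseteq> y; x \<in> carrier A; y \<in> carrier A\<rbrakk> \<Longrightarrow> y \<squnion> x = y"
  unfolding lat_le_def by (metis join_meet_absorb meet_commute)

lemma le_join1: "\<lbrakk>x \<in> carrier A; y \<in> carrier A\<rbrakk> \<Longrightarrow> x \<sqsubseteq> x \<squnion> y"
  by (simp add: lat_le_def meet_join_absorb)

lemma le_join2: "\<lbrakk>x \<in> carrier A; y \<in> carrier A\<rbrakk> \<Longrightarrow> y \<sqsubseteq> x \<squnion> y"
  by (metis join_commute le_join1)

end

section \<open>Implication: transitivity and the lower bound\<close>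

context connexive_heyting_algebra
begin

declare imp_closed [simp, intro]

lemma neg_closed [simp, intro]: "x \<in> carrier A \<Longrightarrow> \<sim> x \<in> carrier A"
  by (simp add: neg_def)

lemma one_imp [simp]: "x \<in> carrier A \<Longrightarrow> \<one> \<leadsto> x = x"
  using C3[of \<one> x] by simp

lemma imp_eq_one_le: "\<lbrakk>x \<leadsto> y = \<one>; x \<in> carrier A; y \<in> carrier A\<rbrakk> \<Longrightarrow> x \<sqsubseteq> y"
  using C3[of x y] by (simp add: lat_le_def)

lemma le_imp_one: "x \<in> carrier A \<Longrightarrow> x \<sqsubseteq> x \<leadsto> \<one>"
  using C3[of x \<one>] by (simp add: lat_le_def)

lemma imp_mp: "\<lbrakk>x \<in> carrier A; y \<in> carrier A\<rbrakk> \<Longrightarrow> x \<sqinter> (x \<leadsto> y) \<sqsubseteq> y"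
  by (simp add: C3 meet_le2)

text \<open>C1, read through C3, is an inequality; modus ponens below \<open>u\<close> then
  eliminates the middle term.\<close>

lemma imp_trans:
  assumes [simp]: "x \<in> carrier A" "y \<in> carrier A" "z \<in> carrier A" "u \<in> carrier A"
    and "u \<sqsubseteq> x \<leadsto> y" "u \<sqsubseteq> y \<leadsto> z"
  shows "u \<sqsubseteq> x \<leadsto> z"
proof -
  have "x \<leadsto> y \<sqsubseteq> (y \<leadsto> z) \<leadsto> (x \<leadsto> z)"
    by (simp add: imp_eq_one_le C1)
  then have "u \<sqsubseteq> (y \<leadsto> z) \<leadsto> (x \<leadsto> z)"
    using assms by (meson le_trans imp_closed)
  then have "u \<sqsubseteq> (y \<leadsto> z) \<sqinter> ((y \<leadsto> z) \<leadsto> (x \<leadsto> z))"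
    using assms by (simp add: le_meetI)
  then show ?thesis
    by (rule le_trans[OF _ imp_mp]) simp_all
qed

lemma le_imp_of_meet_eq:
  assumes [simp]: "u \<in> carrier A" "x \<in> carrier A" "y \<in> carrier A"
    and eq: "u \<sqinter> x = u \<sqinter> y"
  shows "u \<sqsubseteq> x \<leadsto> y"
proof -
  have le: "u \<sqinter> x \<sqsubseteq> x \<sqinter> y"
    using eq by (metis assms(1-3) le_meetI meet_closed meet_le2)
  \<comment> \<open>Since \<open>\<one> \<leadsto> u\<close> is \<open>u\<close>, C4 with
    \<open>x\<close> brings \<open>u\<close> below an implication.\<close>
  have "u \<sqsubseteq> x \<leadsto> x \<sqinter> u"
    using C4[of \<one> u x] by simp
  \<comment> \<open>Joining with \<open>x \<sqinter> y\<close> leaves \<open>x\<close> fixed and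
    swallows \<open>x \<sqinter> u\<close>, which lies below it.\<close>
  moreover have "x \<leadsto> x \<sqinter> u \<sqsubseteq> x \<leadsto> x \<sqinter> y"
    using C5[of x "x \<sqinter> u" "x \<sqinter> y"] le join_absorb2[of "u \<sqinter> x" "x \<sqinter> y"]
      join_absorb2[of "x \<sqinter> y" x]
    by (simp add: meet_le1 meet_commute[of x u] join_commute[of "x \<sqinter> y" x])
  ultimately have 1: "u \<sqsubseteq> x \<leadsto> x \<sqinter> y"
    by (rule le_trans) simp_all
  \<comment> \<open>The second link starts from \<open>u \<sqsubseteq> u \<leadsto> \<one>\<close>:
    meet with \<open>y\<close>, then join with \<open>x \<sqinter> y\<close>, which swallows
    \<open>u \<sqinter> y\<close>.\<close>
  have "u \<leadsto> \<one> \<sqsubseteq> u \<sqinter> y \<leadsto> y"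
    using C4[of u \<one> y] by (simp add: meet_commute[of y u])
  moreover have "u \<sqinter> y \<leadsto> y \<sqsubseteq> x \<sqinter> y \<leadsto> y"
    using C5[of "u \<sqinter> y" y "x \<sqinter> y"] le join_absorb2[of "u \<sqinter> x" "x \<sqinter> y"]
      join_absorb2[of "x \<sqinter> y" y]
    by (simp add: meet_le2 eq join_commute[of "x \<sqinter> y" y])
  ultimately have "u \<sqsubseteq> x \<sqinter> y \<leadsto> y"
    by (meson le_imp_one le_trans assms(1-3) imp_closed meet_closed one_closed)
  with 1 show ?thesis
    by (intro imp_trans[of x "x \<sqinter> y" y u]) simp_all
qed

text \<open>Forward by modus ponens, backward by the lower bound on implication with
  \<open>\<zero>\<close> for \<open>y\<close>.\<close>

lemma le_neg_iff:
  assumes [simp]: "x \<in> carrier A" "z \<in> carrier A"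
  shows "z \<sqsubseteq> \<sim> x \<longleftrightarrow> z \<sqinter> x = \<zero>"
proof
  assume "z \<sqsubseteq> \<sim> x"
  then have "z \<sqinter> x \<sqsubseteq> x \<sqinter> (x \<leadsto> \<zero>)"
    by (metis assms imp_closed le_refl meet_commute meet_mono neg_def zero_closed)
  then show "z \<sqinter> x = \<zero>"
    by (simp add: C3 le_zero)
qed (simp add: neg_def le_imp_of_meet_eq)

section \<open>Pseudocomplement laws and double negation\<close>

lemma neg_meet_self [simp]: "x \<in> carrier A \<Longrightarrow> \<sim> x \<sqinter> x = \<zero>"
  by (metis le_neg_iff le_refl neg_closed)

lemma le_double_neg: "x \<in> carrier A \<Longrightarrow> x \<sqsubseteq> \<sim> (\<sim> x)"
  by (simp add: le_neg_iff meet_commute[of x])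

lemma neg_antimono: "\<lbrakk>x \<sqsubseteq> y; x \<in> carrier A; y \<in> carrier A\<rbrakk> \<Longrightarrow> \<sim> y \<sqsubseteq> \<sim> x"
  by (metis le_neg_iff le_refl le_zero meet_closed meet_mono neg_closed neg_meet_self)

lemma double_neg_mono: "\<lbrakk>x \<sqsubseteq> y; x \<in> carrier A; y \<in> carrier A\<rbrakk> \<Longrightarrow> \<sim> (\<sim> x) \<sqsubseteq> \<sim> (\<sim> y)"
  by (simp add: neg_antimono)

lemma triple_neg [simp]: "x \<in> carrier A \<Longrightarrow> \<sim> (\<sim> (\<sim> x)) = \<sim> x"
  by (simp add: le_antisym le_double_neg neg_antimono)

lemma neg_zero [simp]: "\<sim> \<zero> = \<one>"
  by (meson le_antisym le_neg_iff meet_zero neg_closed one_closed one_greatest zero_closed)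

lemma neg_one [simp]: "\<sim> \<one> = \<zero>"
  by (simp add: neg_def)

text \<open>Disjointness from \<open>x\<close> means lying below \<open>\<sim> x\<close>, which
  triple negation does not change.\<close>

lemma meet_double_neg_eq_zero_iff:
  assumes [simp]: "x \<in> carrier A" "z \<in> carrier A"
  shows "z \<sqinter> \<sim> (\<sim> x) = \<zero> \<longleftrightarrow> z \<sqinter> x = \<zero>"
  by (metis assms le_neg_iff neg_closed triple_neg)

lemma double_neg_meet:
  assumes [simp]: "x \<in> carrier A" "y \<in> carrier A"
  shows "\<sim> (\<sim> (x \<sqinter> y)) = \<sim> (\<sim> x) \<sqinter> \<sim> (\<sim> y)"
proof (rule le_antisym)
  show "\<sim> (\<sim> (x \<sqinter> y)) \<sqsubseteq> \<sim> (\<sim> x) \<sqinter> \<sim> (\<sim> y)"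
    by (simp add: double_neg_mono le_meetI meet_le1 meet_le2)
  let ?n = "\<sim> (x \<sqinter> y)"
  \<comment> \<open>Each factor in turn is rotated into last position, where it may be doubly
    negated.\<close>
  have "(?n \<sqinter> x) \<sqinter> y = \<zero>"
    by (simp add: meet_assoc)
  then have "(?n \<sqinter> x) \<sqinter> \<sim> (\<sim> y) = \<zero>"
    by (simp add: meet_double_neg_eq_zero_iff)
  then have "(?n \<sqinter> \<sim> (\<sim> y)) \<sqinter> x = \<zero>"
    by (simp add: meet_assoc meet_commute[of x])
  then have "(?n \<sqinter> \<sim> (\<sim> y)) \<sqinter> \<sim> (\<sim> x) = \<zero>"
    by (simp add: meet_double_neg_eq_zero_iff)
  then have "(\<sim> (\<sim> x) \<sqinter> \<sim> (\<sim> y)) \<sqinter> ?n = \<zero>"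
    by (metis assms meet_assoc meet_closed meet_commute neg_closed)
  then show "\<sim> (\<sim> x) \<sqinter> \<sim> (\<sim> y) \<sqsubseteq> \<sim> ?n"
    by (simp add: le_neg_iff)
qed simp_all

text \<open>Distributivity reduces disjointness from a join to disjointness from both parts.\<close>

lemma neg_join:
  assumes [simp]: "x \<in> carrier A" "y \<in> carrier A"
  shows "\<sim> (x \<squnion> y) = \<sim> x \<sqinter> \<sim> y"
proof (rule le_antisym)
  show "\<sim> (x \<squnion> y) \<sqsubseteq> \<sim> x \<sqinter> \<sim> y"
    by (simp add: le_meetI neg_antimono le_join1 le_join2)
  have "(\<sim> x \<sqinter> \<sim> y) \<sqinter> x = \<zero>"
    using le_neg_iff[of x "\<sim> x \<sqinter> \<sim> y"] by (simp add: meet_le1)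
  moreover have "(\<sim> x \<sqinter> \<sim> y) \<sqinter> y = \<zero>"
    using le_neg_iff[of y "\<sim> x \<sqinter> \<sim> y"] by (simp add: meet_le2)
  ultimately show "\<sim> x \<sqinter> \<sim> y \<sqsubseteq> \<sim> (x \<squnion> y)"
    by (simp add: le_neg_iff meet_join_distrib)
qed simp_all

section \<open>Upper bounds on implication, and its double negation\<close>

lemma zero_imp_le_neg:
  assumes [simp]: "x \<in> carrier A"
  shows "\<zero> \<leadsto> x \<sqsubseteq> \<sim> x"
proof -
  have zero_imp_one: "\<zero> \<leadsto> \<one> = \<zero>"
  proof -
    \<comment> \<open>In this instance of C2 the negated term is
      \<open>\<zero> \<leadsto> \<zero>\<close>, that is \<open>\<one>\<close>, so the bound
      collapses to \<open>\<zero>\<close>.\<close>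
    have "\<zero> \<leadsto> \<one> \<sqsubseteq> \<sim> (\<zero> \<leadsto> \<sim> \<one>)"
      by (intro imp_eq_one_le C2) simp_all
    then show ?thesis
      using neg_zero by (simp add: neg_def le_zero)
  qed
  \<comment> \<open>C1 through \<open>\<one>\<close> turns the collapse into a negation;
    \<open>x \<sqsubseteq> x \<leadsto> \<one>\<close> and antitonicity then finish.\<close>
  have "\<zero> \<leadsto> x \<sqsubseteq> (x \<leadsto> \<one>) \<leadsto> (\<zero> \<leadsto> \<one>)"
    by (simp add: imp_eq_one_le C1)
  then have "\<zero> \<leadsto> x \<sqsubseteq> \<sim> (x \<leadsto> \<one>)"
    by (simp add: zero_imp_one neg_def)
  then show ?thesis
    by (rule le_trans) (simp_all add: neg_antimono le_imp_one)
qed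

lemma imp_meet_le_double_neg:
  assumes [simp]: "x \<in> carrier A" "y \<in> carrier A"
  shows "(x \<leadsto> y) \<sqinter> y \<sqsubseteq> \<sim> (\<sim> x)"
proof -
  \<comment> \<open>Meeting with \<open>\<sim> x\<close> turns the antecedent into
    \<open>\<zero>\<close>, where \<open>zero_imp_le_neg\<close> applies.\<close>
  have "x \<leadsto> y \<sqsubseteq> \<zero> \<leadsto> \<sim> x \<sqinter> y"
    using C4[of x y "\<sim> x"] by simp
  then have "x \<leadsto> y \<sqsubseteq> \<sim> (\<sim> x \<sqinter> y)"
    by (rule le_trans) (simp_all add: zero_imp_le_neg)
  then have "(x \<leadsto> y) \<sqinter> (\<sim> x \<sqinter> y) = \<zero>"
    by (simp add: le_neg_iff)
  then show ?thesis
    by (simp add: le_neg_iff meet_assoc meet_commute[of y])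
qed

lemma double_neg_imp:
  assumes [simp]: "x \<in> carrier A" "y \<in> carrier A"
  shows "\<sim> (\<sim> (x \<leadsto> y)) = \<sim> (\<sim> x) \<leadsto> \<sim> (\<sim> y)"
proof (rule le_antisym)
  let ?i = "\<sim> (\<sim> (x \<leadsto> y))" and ?x = "\<sim> (\<sim> x)" and ?y = "\<sim> (\<sim> y)"
  \<comment> \<open>For the lower bound, \<open>?i\<close> must meet \<open>?x\<close> and
    \<open>?y\<close> equally; both meets turn out to be \<open>?x \<sqinter> ?y\<close>.\<close>
  have "?i \<sqinter> ?x = \<sim> (\<sim> (x \<sqinter> (x \<leadsto> y)))"
    by (simp add: double_neg_meet meet_commute[of ?i])
  then have ix: "?i \<sqinter> ?x = ?x \<sqinter> ?y"
    by (simp add: C3 double_neg_meet)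
  have "?i \<sqinter> ?y = \<sim> (\<sim> ((x \<leadsto> y) \<sqinter> y))"
    by (simp add: double_neg_meet)
  also have "\<dots> \<sqsubseteq> ?x"
    using double_neg_mono[OF imp_meet_le_double_neg[of x y]] by simp
  finally have "?i \<sqinter> ?y = (?i \<sqinter> ?y) \<sqinter> ?x"
    by (simp add: lat_le_def)
  also have "\<dots> = (?i \<sqinter> ?x) \<sqinter> ?y"
    by (simp add: meet_assoc meet_commute[of ?y])
  also have "\<dots> = ?x \<sqinter> ?y"
    by (simp add: ix meet_assoc meet_idem)
  finally show "?i \<sqsubseteq> ?x \<leadsto> ?y"
    by (simp add: ix le_imp_of_meet_eq)

  \<comment> \<open>\<open>?w\<close> measures the failure of the reverse inequality; by the
    pseudocomplement property it suffices that it is \<open>\<zero>\<close>.\<close>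
  let ?w = "(?x \<leadsto> ?y) \<sqinter> \<sim> (x \<leadsto> y)"
  \<comment> \<open>Equal meets put \<open>v\<close> below \<open>x \<leadsto> y\<close>, while
    \<open>?w\<close> puts it below the negation.\<close>
  have w_zero: "v = \<zero>" if [simp]: "v \<in> carrier A" and "v \<sqsubseteq> ?w" "v \<sqinter> x = v \<sqinter> y" for v
  proof -
    have "v \<sqsubseteq> x \<leadsto> y"
      using that by (simp add: le_imp_of_meet_eq)
    moreover have "v \<sqsubseteq> \<sim> (x \<leadsto> y)"
      using that(2) by (rule le_trans) (simp_all add: meet_le2)
    ultimately show ?thesis
      using le_neg_iff[of "x \<leadsto> y" v] by (simp add: lat_le_def[of _ v "x \<leadsto> y"])
  qed
  have w_imp: "?w \<sqsubseteq> ?x \<leadsto> ?y"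
    by (simp add: meet_le1)
  \<comment> \<open>\<open>?w\<close> is shown disjoint from \<open>x \<sqinter> y\<close>, then
    from \<open>x\<close>, then from \<open>y\<close>, each result feeding the next.\<close>
  have "?w \<sqinter> (x \<sqinter> y) = \<zero>"
  proof (rule w_zero)
    show "?w \<sqinter> (x \<sqinter> y) \<sqsubseteq> ?w"
      by (rule meet_le1) simp_all
    have "(x \<sqinter> y) \<sqinter> x = (x \<sqinter> y) \<sqinter> y"
      using meet_le1[of x y] meet_le2[of x y] by (simp add: lat_le_def)
    then show "?w \<sqinter> (x \<sqinter> y) \<sqinter> x = ?w \<sqinter> (x \<sqinter> y) \<sqinter> y"
      by (simp add: meet_assoc[of ?w])
  qed simp
  then have "(?w \<sqinter> x) \<sqinter> y = \<zero>"
    by (simp add: meet_assoc)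
  then have "(?w \<sqinter> x) \<sqinter> ?y = \<zero>"
    by (subst meet_double_neg_eq_zero_iff) simp_all
  moreover have "?w \<sqinter> x \<sqsubseteq> ?y"
  proof -
    have "?w \<sqinter> x \<sqsubseteq> (?x \<leadsto> ?y) \<sqinter> ?x"
      by (rule meet_mono[OF w_imp le_double_neg]) simp_all
    then show ?thesis
      by (rule le_trans) (simp_all add: imp_mp meet_commute[of _ ?x])
  qed
  ultimately have wx: "?w \<sqinter> x = \<zero>"
    by (simp add: lat_le_def)
  have "?w \<sqinter> y \<sqsubseteq> (?x \<leadsto> ?y) \<sqinter> ?y"
    by (rule meet_mono[OF w_imp le_double_neg]) simp_all
  \<comment> \<open>The upper bound is used at \<open>?x\<close> and \<open>?y\<close>, where triple
    negation removes the extra negations.\<close>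
  then have "?w \<sqinter> y \<sqsubseteq> ?x"
    by (rule le_trans) (use imp_meet_le_double_neg[of ?x ?y] in simp_all)
  moreover have "?w \<sqinter> y \<sqsubseteq> \<sim> x"
    by (rule le_trans[OF meet_le1]) (use wx in \<open>simp_all add: le_neg_iff\<close>)
  ultimately have "?w \<sqinter> y \<sqsubseteq> ?x \<sqinter> \<sim> x"
    by (intro le_meetI) simp_all
  then have "?w \<sqinter> y = \<zero>"
    by (simp add: le_zero)
  \<comment> \<open>Now \<open>?w\<close> itself has equal meets with \<open>x\<close> and
    \<open>y\<close>, both \<open>\<zero>\<close>.\<close>
  then have "?w = \<zero>"
    by (intro w_zero) (use wx in \<open>simp_all add: le_refl\<close>)
  then show "?x \<leadsto> ?y \<sqsubseteq> ?i"
    by (simp add: le_neg_iff)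
qed simp_all

text \<open>Both sides negate \<open>\<sim> x \<sqinter> \<sim> y\<close>. Dropping inner closures
  gives associativity of the new join.\<close>

lemma double_neg_join_double_neg:
  assumes [simp]: "x \<in> carrier A" "y \<in> carrier A"
  shows "\<sim> (\<sim> (x \<squnion> \<sim> (\<sim> y))) = \<sim> (\<sim> (x \<squnion> y))"
  by (simp add: neg_join)

end

section \<open>The algebra of regular elements\<close>

lemma double_neg_algebra_simps [simp]:
  "meet (double_neg_algebra A) = meet A"
  "join (double_neg_algebra A) x y = \<sim>\<^bsub>A\<^esub> (\<sim>\<^bsub>A\<^esub> (x \<squnion>\<^bsub>A\<^esub> y))"
  "imp (double_neg_algebra A) = imp A"
  "zero (double_neg_algebra A) = \<zero>\<^bsub>A\<^esub>"
  "one (double_neg_algebra A) = \<one>\<^bsub>A\<^esub>"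
  "lat_le (double_neg_algebra A) = lat_le A"
  "neg (double_neg_algebra A) = neg A"
  by (simp_all add: double_neg_algebra_def lat_le_def neg_def fun_eq_iff)

text \<open>By triple negation, double negations are fixed points, which gives a membership test
  without a witness.\<close>

lemma carrier_double_neg_algebra:
  assumes "connexive_heyting_algebra A"
  shows "x \<in> carrier (double_neg_algebra A) \<longleftrightarrow> x \<in> carrier A \<and> \<sim>\<^bsub>A\<^esub> (\<sim>\<^bsub>A\<^esub> x) = x"
proof -
  interpret connexive_heyting_algebra A by fact
  show ?thesis
    by (auto simp: double_neg_algebra_def) metis
qed

lemma connexive_boolean_double_neg_algebra:
  fixes A (structure)
  assumes "connexive_heyting_algebra A"
  shows "connexive_boolean_algebra (double_neg_algebra A)"
proof -
  interpret connexive_heyting_algebra A by fact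
  note [simp] = carrier_double_neg_algebra[OF assms]
  show ?thesis
  proof (unfold_locales, goal_cases)
    case (5 x y)
    then show ?case by (simp add: meet_commute)
  next
    case (6 x y)
    then show ?case by (simp add: join_commute)
  next
    case (8 x y z)
    then have "\<sim> (\<sim> (\<sim> (\<sim> (x \<squnion> y)) \<squnion> z)) = \<sim> (\<sim> (x \<squnion> y \<squnion> z))"
      using double_neg_join_double_neg[of z "x \<squnion> y"] by (simp add: join_commute[of _ z])
    moreover have "\<sim> (\<sim> (x \<squnion> \<sim> (\<sim> (y \<squnion> z)))) = \<sim> (\<sim> (x \<squnion> (y \<squnion> z)))"
      using 8 by (intro double_neg_join_double_neg) simp_all
    ultimately show ?case
      using 8 by (simp add: join_assoc)
  next
    case (9 x y)
    \<comment> \<open>A regular \<open>x\<close> may move inside the double negation, where the law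
      of the original lattice applies. Distributivity uses the same device.\<close>
    then have "x \<sqinter> \<sim> (\<sim> (x \<squnion> y)) = \<sim> (\<sim> (x \<sqinter> (x \<squnion> y)))"
      by (simp add: double_neg_meet)
    with 9 show ?case
      by (simp add: meet_join_absorb)
  next
    case (11 x y z)
    then have "x \<sqinter> \<sim> (\<sim> (y \<squnion> z)) = \<sim> (\<sim> (x \<sqinter> (y \<squnion> z)))"
      by (simp add: double_neg_meet)
    with 11 show ?case
      by (simp add: meet_join_distrib)
  next
    case (19 x y z)
    then have "x \<leadsto> y \<sqsubseteq> (z \<squnion> x) \<leadsto> (z \<squnion> y)"
      by (simp add: C5)
    \<comment> \<open>Closing the right side lets double negation distribute over
      \<open>\<leadsto>\<close>, producing the new joins.\<close>
    then have "x \<leadsto> y \<sqsubseteq> \<sim> (\<sim> ((z \<squnion> x) \<leadsto> (z \<squnion> y)))"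
      by (rule le_trans) (use 19 in \<open>simp_all add: le_double_neg\<close>)
    with 19 show ?case
      by (simp add: double_neg_imp)
  \<comment> \<open>C1 to C4 carry over because order and negation are those of \<open>A\<close>;
    closure under \<open>\<sqinter>\<close> and \<open>\<leadsto>\<close> holds because double
    negation preserves them.\<close>
  qed (simp_all add: double_neg_meet double_neg_imp meet_assoc join_meet_absorb
      zero_least one_greatest C1 C2 C3 C4)
qed

theorem theorem3p19:
  fixes A :: "'a heyting_struct"
  assumes "connexive_heyting_algebra A"
  shows "connexive_boolean_algebra (double_neg_algebra A)
    \<and> (\<lambda>a. \<sim>\<^bsub>A\<^esub> (\<sim>\<^bsub>A\<^esub> a)) ` carrier A = carrier (double_neg_algebra A)
    \<and> preserves_meet_imp_bounds A (double_neg_algebra A) (\<lambda>a. \<sim>\<^bsub>A\<^esub> (\<sim>\<^bsub>A\<^esub> a))"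
proof (intro conjI)
  interpret connexive_heyting_algebra A by fact
  show "connexive_boolean_algebra (double_neg_algebra A)"
    using assms by (rule connexive_boolean_double_neg_algebra)
  show "(\<lambda>a. \<sim>\<^bsub>A\<^esub> (\<sim>\<^bsub>A\<^esub> a)) ` carrier A = carrier (double_neg_algebra A)"
    by (auto simp: double_neg_algebra_def)
  show "preserves_meet_imp_bounds A (double_neg_algebra A) (\<lambda>a. \<sim>\<^bsub>A\<^esub> (\<sim>\<^bsub>A\<^esub> a))"
    by (simp add: preserves_meet_imp_bounds_def double_neg_meet double_neg_imp)
qed

end
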